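(* Consider a tiered auction instance (supplies $q_1,\dots,q_L$, bidders $1,\dots,n$ with tiers $\ell(i)$ and marginal valuations $u_i(j)$). If all bidders bid sincerely, then the allocation $(x_1,\dots,x_n)$ computed by the tiered clinching auction (where $x_i$ is the total number of items bidder $i$ clinches) is efficient, i.e. it is a feasible allocation maximizing the social welfare $\sum_{i=1}^n\sum_{k=1}^{x_i}u_i(k)$ over all feasible allocations.
   Context: **Tiered instance.** There are tiers $1,\dots,L$ of items ($1$ lowest quality, $L$ highest). Tier $k$ contains $q_k$ identical items ($q_k$ a nonnegative integer), and $q=\sum_{k=1}^L q_k$. There are $n$ bidders. Bidder $i$ has a tier $\ell(i)\in\{1,\dots,L\}$, the lowest quality it accepts; it accepts items of any tier $\ge\ell(i)$ and is otherwise indifferent to quality. It has marginal valuations $u_i(1)\ge u_i(2)\ge\dots\ge u_i(q)\ge 0$, where $u_i(j)$ is the value of its $j$-th acceptable item. Standing assumptions: the valuations are integers; the positive marginal valuations (over all pairs $(i,j)$) are pairwise distinct; and no submarket is initially undersubscribed, i.e. for every $t\in\{1,\dots,L\}$, $\#\{(i,j): \ell(i)\le t,\ u_i(j)>0\}\ \ge\ \sum_{k=1}^t q_k$. **Feasible allocation.** A vector $(x_1,\dots,x_n)$ of nonnegative integers with $\sum_{i:\ell(i)\ge t}x_i\le\sum_{k=t}^L q_k$ for all $t\in\{1,\dots,L\}$. **Tiered clinching auction under sincere bidding.** State: a price $p$ (initially $0$), remaining supplies $r_k$ (initially $r_k=q_k$), and the number $C_i$ of items clinched so far by bidder $i$ (initially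 $0$). Sincere demand of bidder $i$ at price $p$ is $D_i(p)=\#\{j: u_i(j)>p\}$, and its residual demand is $R_i(p)=\max\{D_i(p)-C_i,0\}$. Submarket $\mathcal M_t$ consists of the items of tiers $\le t$ and the bidders of tiers $\le t$. Repeat the following: (1) Search for a pair $(t,i)$ with $\ell(i)\le t$ and $\sum_{j\ne i,\ \ell(j)\le t}R_j(p)<\sum_{k=1}^t r_k$, going through $t=1,\dots,L$ in increasing order and, for each $t$, through $i=1,\dots,n$ in increasing order. (2) If such a pair exists, take the first one: bidder $i$ clinches an item in submarket $\mathcal M_t$. It is given an item of the lowest tier $s\ge\ell(i)$ with $r_s>0$ and pays $p$ for it; set $r_s\leftarrow r_s-1$, $C_i\leftarrow C_i+1$, and repeat from (1) at the same price. (3) If no such pair exists: if $r_1=\dots=r_L=0$, terminate; otherwise set $p\leftarrow p+1$ and repeat from (1). *)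

theory Defs
  imports Main
begin

text \<open>
  Tiers, bidders and marginal valuations are indexed from 1, so that \<open>supplies M\<close>, \<open>tier M\<close> and
  \<open>valuation M\<close> are meaningful only on \<open>{1..tiers M}\<close>, \<open>{1..bidders M}\<close> and
  \<open>{1..bidders M} \<times> {1..total_supply M}\<close>; values outside these ranges are never constrained.
\<close>

record market =
  tiers :: nat
  supplies :: "nat \<Rightarrow> nat"
  bidders :: nat
  tier :: "nat \<Rightarrow> nat"
  valuation :: "nat \<Rightarrow> nat \<Rightarrow> int"

definition total_supply :: "market \<Rightarrow> nat" where
  "total_supply M = (\<Sum>k = 1..tiers M. supplies M k)"

definition tiered_instance :: "market \<Rightarrow> bool" where
  "tiered_instance M \<longleftrightarrow>
     (\<forall>i\<in>{1..bidders M}. tier M i \<in> {1..tiers M}) \<and>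
     (\<forall>i\<in>{1..bidders M}. \<forall>j\<in>{1..total_supply M}. 0 \<le> valuation M i j) \<and>
     (\<forall>i\<in>{1..bidders M}. \<forall>j\<in>{1..total_supply M}. \<forall>j'\<in>{1..total_supply M}.
        j \<le> j' \<longrightarrow> valuation M i j' \<le> valuation M i j) \<and>
     inj_on (\<lambda>(i, j). valuation M i j)
       {(i, j). i \<in> {1..bidders M} \<and> j \<in> {1..total_supply M} \<and> 0 < valuation M i j} \<and>
     (\<forall>t\<in>{1..tiers M}.
        (\<Sum>k = 1..t. supplies M k) \<le>
        card {(i, j). i \<in> {1..bidders M} \<and> j \<in> {1..total_supply M} \<and>
                      tier M i \<le> t \<and> 0 < valuation M i j})"

definition feasible_allocation :: "market \<Rightarrow> (nat \<Rightarrow> nat) \<Rightarrow> bool" where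
  "feasible_allocation M x \<longleftrightarrow>
     (\<forall>t\<in>{1..tiers M}.
        (\<Sum>i\<in>{i\<in>{1..bidders M}. t \<le> tier M i}. x i) \<le> (\<Sum>k = t..tiers M. supplies M k))"

definition social_welfare :: "market \<Rightarrow> (nat \<Rightarrow> nat) \<Rightarrow> int" where
  "social_welfare M x = (\<Sum>i = 1..bidders M. \<Sum>k = 1..x i. valuation M i k)"

definition efficient :: "market \<Rightarrow> (nat \<Rightarrow> nat) \<Rightarrow> bool" where
  "efficient M x \<longleftrightarrow> feasible_allocation M x \<and>
     (\<forall>y. feasible_allocation M y \<longrightarrow> social_welfare M y \<le> social_welfare M x)"

record state =
  price :: int
  remaining :: "nat \<Rightarrow> nat"
  clinched :: "nat \<Rightarrow> nat"
  paid :: "nat \<Rightarrow> int"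

definition initial_state :: "market \<Rightarrow> state" where
  "initial_state M =
     \<lparr>price = 0, remaining = supplies M, clinched = (\<lambda>_. 0), paid = (\<lambda>_. 0)\<rparr>"

definition sincere_demand :: "market \<Rightarrow> nat \<Rightarrow> int \<Rightarrow> nat" where
  "sincere_demand M i p = card {j\<in>{1..total_supply M}. p < valuation M i j}"

text \<open>Subtraction on \<^typ>\<open>nat\<close> truncates at 0, as required here.\<close>

definition residual_demand :: "market \<Rightarrow> state \<Rightarrow> nat \<Rightarrow> nat" where
  "residual_demand M s i = sincere_demand M i (price s) - clinched s i"

definition can_clinch :: "market \<Rightarrow> state \<Rightarrow> nat \<Rightarrow> nat \<Rightarrow> bool" where
  "can_clinch M s t i \<longleftrightarrow>
     t \<in> {1..tiers M} \<and> i \<in> {1..bidders M} \<and> tier M i \<le> t \<and>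
     (\<Sum>j\<in>{j\<in>{1..bidders M}. j \<noteq> i \<and> tier M j \<le> t}. residual_demand M s j)
       < (\<Sum>k = 1..t. remaining s k)"

definition first_clinch :: "market \<Rightarrow> state \<Rightarrow> nat \<Rightarrow> nat \<Rightarrow> bool" where
  "first_clinch M s t i \<longleftrightarrow> can_clinch M s t i \<and>
     (\<forall>t' i'. can_clinch M s t' i' \<longrightarrow> t < t' \<or> (t = t' \<and> i \<le> i'))"

definition lowest_acceptable :: "market \<Rightarrow> state \<Rightarrow> nat \<Rightarrow> nat \<Rightarrow> bool" where
  "lowest_acceptable M s i k \<longleftrightarrow>
     k \<in> {tier M i..tiers M} \<and> 0 < remaining s k \<and>
     (\<forall>k'\<in>{tier M i..<k}. remaining s k' = 0)"

text \<open>
  The auction is a deterministic transition system. A state in which some bidder can clinch but no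
  acceptable item is left has no successor and is not final either, so a run that got stuck there
  would have no outcome.
\<close>

inductive auction_step :: "market \<Rightarrow> state \<Rightarrow> state \<Rightarrow> bool" for M where
  clinch: "first_clinch M s t i \<Longrightarrow> lowest_acceptable M s i k \<Longrightarrow>
    auction_step M s
      (s\<lparr>remaining := (remaining s)(k := remaining s k - 1),
         clinched := (clinched s)(i := clinched s i + 1),
         paid := (paid s)(i := paid s i + price s)\<rparr>)"
| raise_price: "\<nexists>t i. can_clinch M s t i \<Longrightarrow> \<exists>k\<in>{1..tiers M}. remaining s k \<noteq> 0 \<Longrightarrow>
    auction_step M s (s\<lparr>price := price s + 1\<rparr>)"

definition final_state :: "market \<Rightarrow> state \<Rightarrow> bool" where
  "final_state M s \<longleftrightarrow>
     (\<nexists>t i. can_clinch M s t i) \<and> (\<forall>k\<in>{1..tiers M}. remaining s k = 0)"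

definition auction_outcome :: "market \<Rightarrow> (nat \<Rightarrow> nat) \<Rightarrow> bool" where
  "auction_outcome M x \<longleftrightarrow>
     (\<exists>s. (auction_step M)\<^sup>*\<^sup>* (initial_state M) s \<and> final_state M s \<and> x = clinched s)"

end

theory Submission
  imports Defs
begin

text \<open>
  The proof maintains an efficient allocation of the form \<open>C + y\<close>, where \<open>C\<close> is what has been
  clinched and \<open>y\<close> sells all the remaining items within the residual demands.  A bidder who clinches
  in submarket \<open>t\<close> faces competitors that cannot absorb the supply of that submarket, so \<open>y\<close> gives it
  an item, and this item can be moved from \<open>y\<close> to \<open>C\<close>.  When the price rises from \<open>p\<close> to \<open>p + 1\<close>, at
  most one unit, of value \<open>p + 1\<close>, leaves the demand.  If \<open>y\<close> used it, then, since every submarket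
  stays oversubscribed, it could be exchanged for a unit of value above \<open>p + 1\<close>, contradicting
  efficiency.  At the end nothing remains, hence \<open>y = 0\<close>.
\<close>

section \<open>Sums under a change at one point\<close>

lemma sum_increment:
  fixes f :: "'a \<Rightarrow> nat"
  assumes "finite A"
  shows "sum (f(i := Suc (f i))) A = sum f A + (if i \<in> A then 1 else 0)"
  using assms by induction auto

lemma sum_decrement:
  fixes f :: "'a \<Rightarrow> nat"
  assumes "finite A" "0 < f i"
  shows "sum f A = sum (f(i := f i - 1)) A + (if i \<in> A then 1 else 0)"
  using assms by induction auto

section \<open>Tiers, supplies and sincere demand\<close>

locale tiered_market =
  fixes M :: market
  assumes tiered_instance: "tiered_instance M"
begin

abbreviation low_bidders :: "nat \<Rightarrow> nat set" where
  "low_bidders t \<equiv> {i\<in>{1..bidders M}. tier M i \<le> t}"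

abbreviation high_bidders :: "nat \<Rightarrow> nat set" where
  "high_bidders t \<equiv> {i\<in>{1..bidders M}. t \<le> tier M i}"

text \<open>Replacing the supplies lets one notion of feasibility serve both the remaining items and
  the original market.\<close>

abbreviation fits :: "(nat \<Rightarrow> nat) \<Rightarrow> (nat \<Rightarrow> nat) \<Rightarrow> bool" where
  "fits r y \<equiv> feasible_allocation (M\<lparr>supplies := r\<rparr>) y"

lemma fits_iff:
  "fits r y \<longleftrightarrow> (\<forall>t\<in>{1..tiers M}. sum y (high_bidders t) \<le> sum r {t..tiers M})"
  by (simp add: feasible_allocation_def)

lemma tier_bounds:
  assumes "i \<in> {1..bidders M}"
  shows "1 \<le> tier M i" "tier M i \<le> tiers M"
  using assms tiered_instance by (auto simp: tiered_instance_def)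

lemma valuation_antimono:
  assumes "i \<in> {1..bidders M}" "1 \<le> j" "j \<le> j'" "j' \<le> total_supply M"
  shows "valuation M i j' \<le> valuation M i j"
  using assms tiered_instance unfolding tiered_instance_def by force

lemma positive_valuation_inj:
  assumes "i \<in> {1..bidders M}" "j \<in> {1..total_supply M}"
    and "i' \<in> {1..bidders M}" "j' \<in> {1..total_supply M}"
    and "valuation M i j = valuation M i' j'" "0 < valuation M i j"
  shows "i = i'" "j = j'"
proof -
  have "inj_on (\<lambda>(i, j). valuation M i j)
       {(i, j). i \<in> {1..bidders M} \<and> j \<in> {1..total_supply M} \<and> 0 < valuation M i j}"
    using tiered_instance by (simp add: tiered_instance_def)
  then have "(i, j) = (i', j')"
    by (rule inj_onD) (use assms in auto)
  then show "i = i'" "j = j'" by auto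
qed

lemma low_bidders_tiers: "low_bidders (tiers M) = {1..bidders M}"
  using tier_bounds by force

lemma high_bidders_1: "high_bidders 1 = {1..bidders M}"
  using tier_bounds by force

lemma sum_bidders_split:
  "(sum y {1..bidders M} :: nat) = sum y (low_bidders t) + sum y (high_bidders (Suc t))"
proof -
  have "{1..bidders M} = low_bidders t \<union> high_bidders (Suc t)" by auto
  moreover have "sum y (low_bidders t \<union> high_bidders (Suc t))
      = sum y (low_bidders t) + sum y (high_bidders (Suc t))"
    by (rule sum.union_disjoint) auto
  ultimately show ?thesis by (simp only:)
qed

lemma sum_tiers_split:
  assumes "t \<le> tiers M"
  shows "(sum r {1..tiers M} :: nat) = sum r {1..t} + sum r {Suc t..tiers M}"
proof -
  have "{1..tiers M} = {1..t} \<union> {Suc t..tiers M}" using assms by auto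
  moreover have "sum r ({1..t} \<union> {Suc t..tiers M}) = sum r {1..t} + sum r {Suc t..tiers M}"
    by (rule sum.union_disjoint) auto
  ultimately show ?thesis by (simp only:)
qed

text \<open>Extends the bound past the last tier, where the set of bidders is empty, so that it can
  be applied at \<open>Suc t\<close> for every tier \<open>t\<close>.\<close>

lemma high_sum_le_if_fits:
  assumes "fits r y" "1 \<le> t"
  shows "sum y (high_bidders t) \<le> sum r {t..tiers M}"
proof (cases "t \<le> tiers M")
  case True
  then show ?thesis using assms by (simp add: fits_iff)
next
  case False
  then have "high_bidders t = {}" using tier_bounds(2) by force
  then show ?thesis by (simp only: sum.empty)
qed

lemma total_le_if_fits:
  assumes "fits r y"
  shows "sum y {1..bidders M} \<le> sum r {1..tiers M}"
  using high_sum_le_if_fits[OF assms, of 1] by (simp only: high_bidders_1)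

lemma le_total_supply_if_feasible:
  assumes "feasible_allocation M y" "i \<in> {1..bidders M}"
  shows "y i \<le> total_supply M"
proof -
  have "y i \<le> sum y {1..bidders M}" using assms(2) by (intro member_le_sum) auto
  also have "\<dots> \<le> total_supply M"
    using total_le_if_fits[of "supplies M" y] assms(1) by (simp add: total_supply_def)
  finally show ?thesis .
qed

text \<open>Marginal valuations are nonincreasing, so the demanded units form an initial segment of
  the index range.\<close>

lemma le_sincere_demand_iff:
  assumes "i \<in> {1..bidders M}" "1 \<le> j" "j \<le> total_supply M"
  shows "j \<le> sincere_demand M i p \<longleftrightarrow> p < valuation M i j"
proof -
  let ?A = "{j\<in>{1..total_supply M}. p < valuation M i j}"
  have fin: "finite ?A" by simp
  show ?thesis
  proof
    assume "p < valuation M i j"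
    then have "p < valuation M i k" if "k \<in> {1..j}" for k
      using valuation_antimono[OF assms(1), of k j] assms(3) that by simp
    then have "{1..j} \<subseteq> ?A" using assms(3) by auto
    then show "j \<le> sincere_demand M i p"
      using card_mono[OF fin, of "{1..j}"] by (simp add: sincere_demand_def)
  next
    assume le: "j \<le> sincere_demand M i p"
    show "p < valuation M i j"
    proof (rule ccontr)
      assume "\<not> p < valuation M i j"
      then have "k < j" if "k \<in> ?A" for k
        using valuation_antimono[OF assms(1,2), of k] that by (cases "k < j") auto
      then have "?A \<subseteq> {1..<j}" by auto
      then have "card ?A \<le> card {1..<j}" by (intro card_mono) auto
      then show False using le assms(2) by (simp add: sincere_demand_def)
    qed
  qed
qed

lemma sincere_demand_le: "sincere_demand M i p \<le> total_supply M"
proof -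
  have "sincere_demand M i p \<le> card {1..total_supply M}"
    unfolding sincere_demand_def by (intro card_mono) auto
  then show ?thesis by simp
qed

lemma less_valuation_if_le_sincere_demand:
  assumes "i \<in> {1..bidders M}" "1 \<le> j" "j \<le> sincere_demand M i p"
  shows "p < valuation M i j"
  using assms le_sincere_demand_iff le_trans[OF assms(3) sincere_demand_le] by blast

lemma social_welfare_cong:
  "(\<And>i. i \<in> {1..bidders M} \<Longrightarrow> x i = y i) \<Longrightarrow> social_welfare M x = social_welfare M y"
  by (simp add: social_welfare_def)

text \<open>Allocations are functions on all natural numbers, but feasibility and welfare see only
  their values at bidders.\<close>

lemma efficient_cong:
  assumes "efficient M x" "\<And>i. i \<in> {1..bidders M} \<Longrightarrow> x i = y i"
  shows "efficient M y"
proof -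
  have "sum x (high_bidders t) = sum y (high_bidders t)" for t
    using assms(2) by (intro sum.cong) auto
  then show ?thesis
    using assms social_welfare_cong[of x y] by (simp add: efficient_def feasible_allocation_def)
qed

section \<open>Adding one unit to an allocation\<close>

text \<open>Reduces the comparison of two one-unit extensions of a common base to a comparison of
  two marginal valuations.\<close>

lemma social_welfare_add_unit:
  assumes "h \<in> {1..bidders M}"
  shows "social_welfare M (x(h := Suc (x h))) = social_welfare M x + valuation M h (Suc (x h))"
proof -
  have "social_welfare M z
      = (\<Sum>k = 1..z h. valuation M h k) + (\<Sum>i\<in>{1..bidders M} - {h}. \<Sum>k = 1..z i. valuation M i k)" for z
    unfolding social_welfare_def using assms by (simp add: sum.remove)
  from this[of x] this[of "x(h := Suc (x h))"] show ?thesis by simp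
qed

text \<open>
  The unit is added below the smallest tight constraint \<open>t\<close>: the tiers below \<open>t\<close> are not sold out,
  while their demand \<open>B\<close> covers their supply.
\<close>

lemma fits_augment:
  assumes fit: "fits r z"
    and le: "\<And>i. i \<in> {1..bidders M} \<Longrightarrow> z i \<le> B i"
    and cover: "\<And>t. t \<in> {1..tiers M} \<Longrightarrow> sum r {1..t} \<le> sum B (low_bidders t)"
    and not_full: "sum z {1..bidders M} < sum r {1..tiers M}"
  obtains h where "h \<in> {1..bidders M}" "z h < B h" "fits r (z(h := Suc (z h)))"
proof -
  let ?tight = "\<lambda>t. 1 \<le> t \<and> sum z (high_bidders t) = sum r {t..tiers M}"
  define t0 where "t0 = (LEAST t. ?tight t)"
  \<comment> \<open>Beyond the last tier both sums are empty, so a tight constraint always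
    exists.\<close>
  have "?tight (Suc (tiers M))" using tier_bounds(2) by force
  then have tight: "?tight t0" and t0_le: "t0 \<le> Suc (tiers M)"
    unfolding t0_def by (rule LeastI, rule Least_le)
  have not_tight: "sum z (high_bidders t) < sum r {t..tiers M}" if "1 \<le> t" "t < t0" for t
    using not_less_Least[of t ?tight] that high_sum_le_if_fits[OF fit, of t]
    unfolding t0_def by fastforce
  have "t0 \<noteq> 1" using tight not_full high_bidders_1 by auto
  with tight obtain t where t: "t0 = Suc t" "1 \<le> t" by (cases t0) auto
  \<comment> \<open>Subtract the tight constraint at \<open>Suc t\<close> from the strict inequality
    between the totals.\<close>
  have "sum z (low_bidders t) < sum r {1..t}"
    using sum_bidders_split[of z t] sum_tiers_split[of t r] t t0_le tight not_full by simp
  also have "\<dots> \<le> sum B (low_bidders t)" using cover t t0_le by simp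
  finally obtain h where h: "h \<in> low_bidders t" "z h < B h"
    by (meson linorder_not_le sum_mono)
  \<comment> \<open>The tier of \<open>h\<close> is at most \<open>t\<close>, so the new unit enters
    only constraints below \<open>t0\<close>, all of which have slack.\<close>
  have "fits r (z(h := Suc (z h)))"
    unfolding fits_iff
  proof
    fix t' assume t': "t' \<in> {1..tiers M}"
    have "sum (z(h := Suc (z h))) (high_bidders t')
        = sum z (high_bidders t') + (if t' \<le> tier M h then 1 else 0)"
      using h(1) sum_increment[of "high_bidders t'" z h] by simp
    also have "\<dots> \<le> sum r {t'..tiers M}"
      using not_tight[of t'] high_sum_le_if_fits[OF fit, of t'] t' t h(1) by auto
    finally show "sum (z(h := Suc (z h))) (high_bidders t') \<le> sum r {t'..tiers M}" .
  qed
  then show thesis using that h by auto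
qed

section \<open>Invariant of the auction\<close>

text \<open>The standing assumption on submarkets, carried over to remaining supplies and residual
  demands.\<close>

definition oversubscribed :: "state \<Rightarrow> bool" where
  "oversubscribed s \<longleftrightarrow>
    (\<forall>t\<in>{1..tiers M}. sum (remaining s) {1..t} \<le> sum (residual_demand M s) (low_bidders t))"

text \<open>An inequality rather than an equation, because an item of tier at least \<open>t\<close>
  may have gone to a bidder of tier below \<open>t\<close>.\<close>

definition within_supply :: "state \<Rightarrow> bool" where
  "within_supply s \<longleftrightarrow>
    (\<forall>t\<in>{1..tiers M}. sum (clinched s) (high_bidders t) + sum (remaining s) {t..tiers M}
       \<le> sum (supplies M) {t..tiers M})"

text \<open>Equality of the totals forces a clinching bidder to receive an item from
  \<open>y\<close>, and forces \<open>y\<close> to vanish on the bidders once nothing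
  remains.\<close>

definition efficient_completion :: "state \<Rightarrow> (nat \<Rightarrow> nat) \<Rightarrow> bool" where
  "efficient_completion s y \<longleftrightarrow>
    fits (remaining s) y \<and> sum y {1..bidders M} = sum (remaining s) {1..tiers M} \<and>
    (\<forall>i\<in>{1..bidders M}. y i \<le> residual_demand M s i) \<and>
    efficient M (\<lambda>i. clinched s i + y i)"

text \<open>The price is kept nonnegative because only positive valuations are known to be
  distinct.\<close>

definition invariant :: "state \<Rightarrow> bool" where
  "invariant s \<longleftrightarrow> 0 \<le> price s \<and> oversubscribed s \<and> within_supply s \<and> (\<exists>y. efficient_completion s y)"

lemma oversubscribedD:
  assumes "oversubscribed s" "t \<le> tiers M"
  shows "sum (remaining s) {1..t} \<le> sum (residual_demand M s) (low_bidders t)"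
  using assms by (cases "t = 0") (auto simp: oversubscribed_def)

text \<open>Allows any allocation of the remaining items, not just the completion in the invariant,
  to compete with the efficient one.\<close>

lemma feasible_if_within_supply:
  assumes "within_supply s" "fits (remaining s) y"
  shows "feasible_allocation M (\<lambda>i. clinched s i + y i)"
  using assms unfolding within_supply_def fits_iff feasible_allocation_def
  by (force simp: sum.distrib)

section \<open>Clinching an item\<close>

text \<open>The submarket just below the tier of \<open>i\<close> is oversubscribed without
  \<open>i\<close>, so the demand of \<open>i\<close> comes on top.\<close>

lemma below_demand_if_can_clinch:
  assumes over: "oversubscribed s" and can: "can_clinch M s t i" and le: "tier M i \<le> t'"
  shows "sum (remaining s) {1..tier M i - 1} + residual_demand M s i
    \<le> sum (residual_demand M s) (low_bidders t')"
proof -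
  let ?l = "tier M i"
  have i: "i \<in> {1..bidders M}" using can by (auto simp: can_clinch_def)
  have "sum (remaining s) {1..?l - 1} + residual_demand M s i
      \<le> sum (residual_demand M s) (low_bidders (?l - 1)) + residual_demand M s i"
    using oversubscribedD[OF over, of "?l - 1"] tier_bounds[OF i] by simp
  also have "\<dots> = sum (residual_demand M s) (insert i (low_bidders (?l - 1)))"
    by (subst sum.insert) (use tier_bounds(1)[OF i] in auto)
  also have "\<dots> \<le> sum (residual_demand M s) (low_bidders t')"
    using i le by (intro sum_mono2) auto
  finally show ?thesis .
qed

lemma can_clinch_remove:
  assumes "can_clinch M s t i"
  shows "sum (residual_demand M s) (low_bidders t)
    = residual_demand M s i + sum (residual_demand M s) {j\<in>{1..bidders M}. j \<noteq> i \<and> tier M j \<le> t}"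
proof -
  have "low_bidders t - {i} = {j\<in>{1..bidders M}. j \<noteq> i \<and> tier M j \<le> t}" by auto
  then show ?thesis
    using assms sum.remove[of "low_bidders t" i "residual_demand M s"] by (simp add: can_clinch_def)
qed

text \<open>All bidders of the submarket together cover its supply, but the competitors of
  \<open>i\<close> alone do not.\<close>

lemma residual_demand_pos_if_can_clinch:
  assumes "oversubscribed s" "can_clinch M s t i"
  shows "0 < residual_demand M s i"
  using can_clinch_remove[OF assms(2)] assms oversubscribedD[OF assms(1), of t]
  by (simp add: can_clinch_def)

text \<open>Shows that clinching never gets stuck. If only tiers below that of \<open>i\<close> had
  items left in submarket \<open>t\<close>, the other bidders would already cover its whole
  supply.\<close>

lemma ex_lowest_acceptable:
  assumes over: "oversubscribed s" and can: "can_clinch M s t i"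
  obtains k where "lowest_acceptable M s i k"
proof -
  let ?P = "\<lambda>k. k \<in> {tier M i..tiers M} \<and> 0 < remaining s k"
  have t: "tier M i \<le> t" "t \<le> tiers M" and i: "i \<in> {1..bidders M}"
    using can by (auto simp: can_clinch_def)
  have "sum (remaining s) {1..tier M i - 1} < sum (remaining s) {1..t}"
    using below_demand_if_can_clinch[OF assms t(1)] can_clinch_remove[OF can] can
    by (simp add: can_clinch_def)
  moreover have "{1..t} = {1..tier M i - 1} \<union> {tier M i..t}"
    using t tier_bounds(1)[OF i] by auto
  ultimately have "sum (remaining s) {tier M i..t} \<noteq> 0"
    by (metis add.right_neutral finite_atLeastAtMost nat_less_le sum_Un_nat diff_le_self not_le)
  then obtain k where "?P k" using t by fastforce
  then have "?P (LEAST k. ?P k)" by (rule LeastI)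
  moreover have "remaining s k' = 0" if "k' \<in> {tier M i..<LEAST k. ?P k}" for k'
    using not_less_Least[of k' ?P] that calculation by auto
  ultimately show thesis using that unfolding lowest_acceptable_def by blast
qed

text \<open>One unit of \<open>i\<close> moves from the completion to the clinched items. The
  delicate constraints are those between the tier of \<open>i\<close> and the possibly higher tier
  \<open>k\<close> of the item; the tiers from that of \<open>i\<close> up to \<open>k - 1\<close>
  are sold out.\<close>

lemma invariant_clinch:
  assumes inv: "invariant s" and first: "first_clinch M s t i" and low: "lowest_acceptable M s i k"
  shows "invariant (s\<lparr>remaining := (remaining s)(k := remaining s k - 1),
         clinched := (clinched s)(i := clinched s i + 1),
         paid := (paid s)(i := paid s i + price s)\<rparr>)" (is "invariant ?s'")
proof -
  define s' where "s' = ?s'"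
  have over: "oversubscribed s" and within: "within_supply s" and "0 \<le> price s"
    using inv by (auto simp: invariant_def)
  obtain y where y: "efficient_completion s y" using inv by (auto simp: invariant_def)
  have can: "can_clinch M s t i" using first by (simp add: first_clinch_def)
  have i: "i \<in> {1..bidders M}" and t: "t \<in> {1..tiers M}" "tier M i \<le> t"
    using can by (auto simp: can_clinch_def)
  have k: "tier M i \<le> k" "k \<le> tiers M" "0 < remaining s k"
    and zero: "\<And>k'. tier M i \<le> k' \<Longrightarrow> k' < k \<Longrightarrow> remaining s k' = 0"
    using low by (auto simp: lowest_acceptable_def)
  have remaining: "remaining s' = (remaining s)(k := remaining s k - 1)"
    and clinched: "clinched s' = (clinched s)(i := Suc (clinched s i))"
    and price: "price s' = price s"
    by (simp_all add: s'_def)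
  have demand: "residual_demand M s' = (residual_demand M s)(i := residual_demand M s i - 1)"
    by (auto simp: residual_demand_def clinched price)
  note pos = residual_demand_pos_if_can_clinch[OF over can]
  have sum_remaining: "sum (remaining s) A = sum (remaining s') A + (if k \<in> A then 1 else 0)"
    if "finite A" for A
    unfolding remaining by (fact sum_decrement[of A "remaining s" k, OF that k(3)])
  have sum_demand: "sum (residual_demand M s) A = sum (residual_demand M s') A + (if i \<in> A then 1 else 0)"
    if "finite A" for A
    unfolding demand by (fact sum_decrement[of A "residual_demand M s" i, OF that pos])
  have sum_clinched: "sum (clinched s') A = sum (clinched s) A + (if i \<in> A then 1 else 0)"
    if "finite A" for A
    unfolding clinched by (fact sum_increment[OF that])

  have "oversubscribed s'"
    unfolding oversubscribed_def
  proof
    fix t' assume t': "t' \<in> {1..tiers M}"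
    have le: "sum (remaining s) {1..t'} \<le> sum (residual_demand M s) (low_bidders t')"
      using oversubscribedD[OF over] t' by simp
    \<comment> \<open>Here demand drops by one while supply does not, so strictness is needed. It
      comes from the positive demand of \<open>i\<close>, as the supply lies entirely below the tier
      of \<open>i\<close>.\<close>
    have gap: "sum (remaining s) {1..t'} < sum (residual_demand M s) (low_bidders t')"
      if "tier M i \<le> t'" "t' < k"
    proof -
      have "sum (remaining s) {1..t'} = sum (remaining s) {1..tier M i - 1}"
        by (intro sum.mono_neutral_right) (use that zero in auto)
      then show ?thesis using below_demand_if_can_clinch[OF over can that(1)] pos by simp
    qed
    show "sum (remaining s') {1..t'} \<le> sum (residual_demand M s') (low_bidders t')"
      using sum_remaining[of "{1..t'}"] sum_demand[of "low_bidders t'"] le gap i k(1) tier_bounds(1)[OF i]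
      by (auto split: if_splits)
  qed
  \<comment> \<open>As \<open>tier M i \<le> k\<close>, the remaining sum shrinks whenever the
    clinched sum grows.\<close>
  moreover have "within_supply s'"
    unfolding within_supply_def
  proof
    fix t' assume t': "t' \<in> {1..tiers M}"
    then show "sum (clinched s') (high_bidders t') + sum (remaining s') {t'..tiers M}
       \<le> sum (supplies M) {t'..tiers M}"
      using within sum_clinched[of "high_bidders t'"] sum_remaining[of "{t'..tiers M}"] k
      unfolding within_supply_def by (fastforce split: if_splits)
  qed
  moreover have "efficient_completion s' (y(i := y i - 1))"
  proof -
    have fit: "fits (remaining s) y" and full: "sum y {1..bidders M} = sum (remaining s) {1..tiers M}"
      and le: "\<And>j. j \<in> {1..bidders M} \<Longrightarrow> y j \<le> residual_demand M s j"
      and eff: "efficient M (\<lambda>i. clinched s i + y i)"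
      using y by (auto simp: efficient_completion_def)
    \<comment> \<open>Everything is sold and the bidders above \<open>t\<close> fit into the tiers
      above \<open>t\<close>, so the bidders up to \<open>t\<close> absorb the whole supply of the
      submarket. Without \<open>i\<close> their demand is too small.\<close>
    have y_pos: "0 < y i"
    proof (rule ccontr)
      assume "\<not> 0 < y i"
      have "sum (remaining s) {1..t} \<le> sum y (low_bidders t)"
        using full sum_bidders_split[of y t] sum_tiers_split[of t "remaining s"] t
          high_sum_le_if_fits[OF fit, of "Suc t"] by simp
      also have "\<dots> = sum y {j\<in>{1..bidders M}. j \<noteq> i \<and> tier M j \<le> t}"
        by (intro sum.mono_neutral_right) (use \<open>\<not> 0 < y i\<close> in auto)
      also have "\<dots> \<le> sum (residual_demand M s) {j\<in>{1..bidders M}. j \<noteq> i \<and> tier M j \<le> t}"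
        using le by (intro sum_mono) auto
      finally show False using can by (simp add: can_clinch_def)
    qed
    note sum_y = sum_decrement[of _ y i, OF _ y_pos]
    have "fits (remaining s') (y(i := y i - 1))"
      unfolding fits_iff
    proof
      fix t' assume t': "t' \<in> {1..tiers M}"
      \<comment> \<open>Here the supply loses an item while the unit of \<open>i\<close> is not
        counted. The constraint at the tier of \<open>i\<close> has the same supply but also counts
        that unit.\<close>
      have gap: "sum y (high_bidders t') < sum (remaining s) {t'..tiers M}" if "tier M i < t'" "t' \<le> k"
      proof -
        have "sum y (high_bidders t') < sum y (insert i (high_bidders t'))"
          using y_pos that by simp
        also have "\<dots> \<le> sum y (high_bidders (tier M i))"
          using i that by (intro sum_mono2) auto
        also have "\<dots> \<le> sum (remaining s) {tier M i..tiers M}"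
          using high_sum_le_if_fits[OF fit] tier_bounds(1)[OF i] by simp
        also have "\<dots> = sum (remaining s) {t'..tiers M}"
          by (intro sum.mono_neutral_right) (use that zero in auto)
        finally show ?thesis .
      qed
      show "sum (y(i := y i - 1)) (high_bidders t') \<le> sum (remaining s') {t'..tiers M}"
        using sum_y[of "high_bidders t'"] sum_remaining[of "{t'..tiers M}"] gap i k
          high_sum_le_if_fits[OF fit, of t'] t'
        by (auto split: if_splits)
    qed
    moreover have "sum (y(i := y i - 1)) {1..bidders M} = sum (remaining s') {1..tiers M}"
      using full sum_y[of "{1..bidders M}"] sum_remaining[of "{1..tiers M}"] i k tier_bounds(1)[OF i]
      by auto
    \<comment> \<open>The combined allocation is unchanged, so it stays efficient;
      \<open>y_pos\<close> makes the subtraction exact.\<close>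
    moreover have "(\<lambda>j. clinched s' j + (y(i := y i - 1)) j) = (\<lambda>j. clinched s j + y j)"
      using y_pos by (auto simp: clinched)
    ultimately show ?thesis
      using le eff unfolding efficient_completion_def demand by (simp add: diff_le_mono)
  qed
  ultimately have "invariant s'" using \<open>0 \<le> price s\<close> price unfolding invariant_def by auto
  then show ?thesis by (simp only: s'_def)
qed

section \<open>Raising the price\<close>

text \<open>Valuations are integers, so only units of value \<open>p + 1\<close> leave the demand;
  this value is positive, hence at most one unit has it.\<close>

lemma sincere_demand_raise:
  assumes "0 \<le> p"
  obtains i where
    "\<And>j. j \<in> {1..bidders M} \<Longrightarrow> j \<noteq> i \<Longrightarrow> sincere_demand M j (p + 1) = sincere_demand M j p"
    "\<And>j. j \<in> {1..bidders M} \<Longrightarrow> sincere_demand M j p \<le> Suc (sincere_demand M j (p + 1))"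
proof (cases "\<exists>i j. i \<in> {1..bidders M} \<and> j \<in> {1..total_supply M} \<and> valuation M i j = p + 1")
  case False
  then have "{j\<in>{1..total_supply M}. p + 1 < valuation M i j} = {j\<in>{1..total_supply M}. p < valuation M i j}"
    if "i \<in> {1..bidders M}" for i
    using that by (smt (verit) Collect_cong)
  \<comment> \<open>No demand changes, so the choice of the exceptional index is arbitrary.\<close>
  then show thesis using that[of 0] by (simp add: sincere_demand_def)
next
  case True
  then obtain i j where ij: "i \<in> {1..bidders M}" "j \<in> {1..total_supply M}" "valuation M i j = p + 1"
    by blast
  have unique: "i' = i \<and> j' = j" if "i' \<in> {1..bidders M}" "j' \<in> {1..total_supply M}" "valuation M i' j' = p + 1" for i' j'
    using positive_valuation_inj[OF that(1,2) ij(1,2)] that(3) ij(3) assms by simp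
  have same: "sincere_demand M i' (p + 1) = sincere_demand M i' p"
    if "i' \<in> {1..bidders M}" "i' \<noteq> i" for i'
    unfolding sincere_demand_def using unique[of i'] that by (smt (verit) Collect_cong)
  have "{k\<in>{1..total_supply M}. p < valuation M i k}
      \<subseteq> insert j {k\<in>{1..total_supply M}. p + 1 < valuation M i k}"
    using unique[OF ij(1)] by (smt (verit) insertCI mem_Collect_eq subsetI)
  then have "sincere_demand M i p \<le> card (insert j {k\<in>{1..total_supply M}. p + 1 < valuation M i k})"
    unfolding sincere_demand_def by (intro card_mono) auto
  then have "sincere_demand M i p \<le> Suc (sincere_demand M i (p + 1))"
    unfolding sincere_demand_def using card_insert_le_m1 by (simp add: card_insert_if split: if_splits)
  then show thesis using that[of i] same by (metis le_SucI order_refl)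
qed

text \<open>The completion stays the same; what has to be shown is that it respects the reduced
  demands.\<close>

lemma invariant_raise_price:
  assumes inv: "invariant s" and no_clinch: "\<nexists>t i. can_clinch M s t i"
  shows "invariant (s\<lparr>price := price s + 1\<rparr>)" (is "invariant ?s'")
proof -
  define s' where "s' = ?s'"
  have s': "price s' = price s + 1" "remaining s' = remaining s" "clinched s' = clinched s"
    by (simp_all add: s'_def)
  have over: "oversubscribed s" and within: "within_supply s" and price: "0 \<le> price s"
    using inv by (auto simp: invariant_def)
  obtain y where fit: "fits (remaining s) y"
    and full: "sum y {1..bidders M} = sum (remaining s) {1..tiers M}"
    and le: "\<And>j. j \<in> {1..bidders M} \<Longrightarrow> y j \<le> residual_demand M s j"
    and eff: "efficient M (\<lambda>i. clinched s i + y i)"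
    using inv by (auto simp: invariant_def efficient_completion_def)
  obtain i where
    "\<And>j. j \<in> {1..bidders M} \<Longrightarrow> j \<noteq> i \<Longrightarrow> sincere_demand M j (price s + 1) = sincere_demand M j (price s)"
    and "\<And>j. j \<in> {1..bidders M} \<Longrightarrow> sincere_demand M j (price s) \<le> Suc (sincere_demand M j (price s + 1))"
    using sincere_demand_raise[OF price] by blast
  then have same: "j \<noteq> i \<Longrightarrow> residual_demand M s' j = residual_demand M s j"
    and drop: "residual_demand M s j \<le> Suc (residual_demand M s' j)" if "j \<in> {1..bidders M}" for j
    using that unfolding residual_demand_def s'
    by (fastforce, smt (verit) Suc_diff_le diff_le_mono diff_is_0_eq le_Suc_eq nat_le_linear
        not_less_eq_eq zero_le)
  have over': "oversubscribed s'"
    unfolding oversubscribed_def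
  proof
    fix t assume t: "t \<in> {1..tiers M}"
    let ?others = "{j\<in>{1..bidders M}. j \<noteq> i \<and> tier M j \<le> t}"
    have others: "sum (residual_demand M s') ?others = sum (residual_demand M s) ?others"
      using same by (intro sum.cong) auto
    have "sum (remaining s) {1..t} \<le> sum (residual_demand M s') (low_bidders t)"
    proof (cases "i \<in> low_bidders t")
      \<comment> \<open>As \<open>i\<close> cannot clinch, its competitors cover the supply alone,
        and their demands do not change.\<close>
      case True
      then have "sum (remaining s) {1..t} \<le> sum (residual_demand M s) ?others"
        using no_clinch t by (auto simp: can_clinch_def not_less)
      also have "\<dots> \<le> sum (residual_demand M s') (low_bidders t)"
        unfolding others[symmetric] by (intro sum_mono2) auto
      finally show ?thesis .
    next
      case False
      then have "?others = low_bidders t" by auto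
      then show ?thesis using others oversubscribedD[OF over] t by simp
    qed
    then show "sum (remaining s') {1..t} \<le> sum (residual_demand M s') (low_bidders t)" by (simp only: s')
  qed
  have "y j \<le> residual_demand M s' j" if j: "j \<in> {1..bidders M}" for j
  proof (rule ccontr)
    assume "\<not> y j \<le> residual_demand M s' j"
    then have y_j: "y j = Suc (residual_demand M s' j)" "y j = residual_demand M s j"
      using le[OF j] drop[OF j] by auto
    have "j = i" using same[OF j] y_j by auto
    \<comment> \<open>Giving up the unit that left the demand brings the allocation within the new
      demands and frees an item, which \<open>fits_augment\<close> hands to some
      \<open>h\<close>.\<close>
    define z where "z = y(j := y j - 1)"
    have y_eq: "y = z(j := Suc (z j))" using y_j by (auto simp: z_def)
    have z_le_y: "z k \<le> y k" for k by (simp add: z_def)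
    have z_le: "z k \<le> residual_demand M s' k" if "k \<in> {1..bidders M}" for k
      using that le[OF that] same[OF that] y_j \<open>j = i\<close> by (auto simp: z_def)
    have "fits (remaining s) z"
      using fit sum_mono[of _ z y] z_le_y unfolding fits_iff by (meson order_trans)
    moreover have "sum z {1..bidders M} < sum (remaining s) {1..tiers M}"
      unfolding full[symmetric]
      by (rule sum_strict_mono_ex1) (use j z_le_y y_j in \<open>auto simp: z_def intro!: bexI[of _ j]\<close>)
    moreover have "sum (remaining s) {1..t} \<le> sum (residual_demand M s') (low_bidders t)"
      if "t \<in> {1..tiers M}" for t
      using oversubscribedD[OF over', of t] that by (simp add: s')
    ultimately obtain h where h: "h \<in> {1..bidders M}" "z h < residual_demand M s' h"
      "fits (remaining s) (z(h := Suc (z h)))"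
      using fits_augment[of "remaining s" z "residual_demand M s'"] z_le by blast
    \<comment> \<open>The common base: \<open>x_j\<close> recovers the efficient allocation and
      \<open>x_h\<close> its rival.\<close>
    define x where "x = (\<lambda>k. clinched s k + z k)"
    have x_h: "x(h := Suc (x h)) = (\<lambda>k. clinched s k + (z(h := Suc (z h))) k)"
      and x_j: "x(j := Suc (x j)) = (\<lambda>k. clinched s k + y k)"
      using y_eq by (auto simp: x_def)
    have "social_welfare M (x(h := Suc (x h))) \<le> social_welfare M (x(j := Suc (x j)))"
      using eff feasible_if_within_supply[OF within h(3)] unfolding x_h x_j efficient_def by blast
    then have "valuation M h (Suc (x h)) \<le> valuation M j (Suc (x j))"
      by (simp only: social_welfare_add_unit[OF h(1)] social_welfare_add_unit[OF j])
    \<comment> \<open>The unit of \<open>h\<close> is still demanded at the new price, that of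
      \<open>j\<close> only at the old one, so the exchange would raise welfare.\<close>
    moreover have "Suc (x h) \<le> sincere_demand M h (price s + 1)"
      using h(2) by (simp add: x_def residual_demand_def s')
    then have "price s + 1 < valuation M h (Suc (x h))"
      using less_valuation_if_le_sincere_demand[OF h(1)] by simp
    moreover have "Suc (x j) \<le> sincere_demand M j (price s)"
      "\<not> Suc (x j) \<le> sincere_demand M j (price s + 1)"
      using y_j by (auto simp: x_def z_def residual_demand_def s')
    then have "valuation M j (Suc (x j)) \<le> price s + 1"
      using le_sincere_demand_iff[OF j, of "Suc (x j)"] sincere_demand_le[of j "price s"]
      by (auto simp: not_less)
    ultimately show False by linarith
  qed
  then have "efficient_completion s' y"
    using fit full eff by (simp add: efficient_completion_def s')
  then have "invariant s'" using price over' within by (auto simp: invariant_def within_supply_def s')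
  then show ?thesis by (simp only: s'_def)
qed

section \<open>The initial state\<close>

text \<open>Welfare is bounded on feasible allocations, so it has a maximum among those within the
  demands at price 0. Truncating a feasible allocation to these demands discards only units of value
  0.\<close>

lemma ex_efficient_within_demand:
  obtains y where "fits (supplies M) y" "\<And>i. i \<in> {1..bidders M} \<Longrightarrow> y i \<le> sincere_demand M i 0"
    "efficient M y"
proof -
  let ?D = "\<lambda>i. sincere_demand M i 0"
  let ?P = "\<lambda>y. feasible_allocation M y \<and> (\<forall>i\<in>{1..bidders M}. y i \<le> ?D i)"
  let ?b = "\<Sum>i = 1..bidders M. \<Sum>k = 1..total_supply M. valuation M i k"
  have nonneg: "0 \<le> valuation M i k" if "i \<in> {1..bidders M}" "k \<in> {1..total_supply M}" for i k
    using tiered_instance that by (simp add: tiered_instance_def)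
  have welfare_le: "social_welfare M y \<le> ?b" if "feasible_allocation M y" for y
    unfolding social_welfare_def
    by (intro sum_mono sum_mono2) (use le_total_supply_if_feasible[OF that] nonneg in auto)
  \<comment> \<open>The maximum is taken over natural numbers, and nonnegativity makes the
    conversion by \<open>nat\<close> faithful.\<close>
  have welfare_nonneg: "0 \<le> social_welfare M y" if "feasible_allocation M y" for y
    unfolding social_welfare_def
    by (intro sum_nonneg) (use le_total_supply_if_feasible[OF that] nonneg in force)
  have "?P (\<lambda>_. 0)" by (simp add: feasible_allocation_def)
  moreover have "\<forall>y. ?P y \<longrightarrow> nat (social_welfare M y) < Suc (nat ?b)"
    using welfare_le by (simp add: less_Suc_eq_le nat_mono)
  ultimately obtain y where y: "?P y"
    and y_max: "\<And>z. ?P z \<Longrightarrow> nat (social_welfare M z) \<le> nat (social_welfare M y)"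
    using Lattices_Big.ex_has_greatest_nat[of ?P _ "\<lambda>y. nat (social_welfare M y)"] by blast
  have "efficient M y"
    unfolding efficient_def
  proof (intro conjI allI impI)
    show "feasible_allocation M y" using y by simp
    fix z assume z: "feasible_allocation M z"
    define z' where "z' = (\<lambda>i. min (z i) (?D i))"
    have "sum z' A \<le> sum z A" for A by (intro sum_mono) (simp add: z'_def)
    then have z': "?P z'"
      using z unfolding feasible_allocation_def by (auto simp: z'_def intro: order_trans)
    have "social_welfare M z = social_welfare M z'"
      unfolding social_welfare_def
    proof (rule sum.cong[OF refl], rule sum.mono_neutral_right)
      fix i assume i: "i \<in> {1..bidders M}"
      show "\<forall>k\<in>{1..z i} - {1..z' i}. valuation M i k = 0"
        using le_sincere_demand_iff[OF i, of _ 0] le_total_supply_if_feasible[OF z i] nonneg[OF i]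
        by (fastforce simp: z'_def)
    qed (auto simp: z'_def)
    then show "social_welfare M z \<le> social_welfare M y"
      using y_max[OF z'] welfare_nonneg y by (simp add: nat_le_eq_zle)
  qed
  then show thesis using that[of y] y by (simp add: feasible_allocation_def)
qed

lemma invariant_initial: "invariant (initial_state M)"
proof -
  let ?s = "initial_state M"
  let ?D = "\<lambda>i. sincere_demand M i 0"
  have demand: "residual_demand M ?s = ?D"
    by (simp add: fun_eq_iff residual_demand_def initial_state_def)
  have cover: "sum (supplies M) {1..t} \<le> sum ?D (low_bidders t)" if "t \<in> {1..tiers M}" for t
  proof -
    \<comment> \<open>Counting the pairs bidder by bidder turns the standing assumption into a bound
      by demands.\<close>
    have "{(i, j). i \<in> {1..bidders M} \<and> j \<in> {1..total_supply M} \<and> tier M i \<le> t \<and> 0 < valuation M i j}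
        = Sigma (low_bidders t) (\<lambda>i. {j\<in>{1..total_supply M}. 0 < valuation M i j})"
      by auto
    then have "card {(i, j). i \<in> {1..bidders M} \<and> j \<in> {1..total_supply M} \<and> tier M i \<le> t \<and> 0 < valuation M i j}
        = sum ?D (low_bidders t)"
      by (simp add: sincere_demand_def)
    then show ?thesis using tiered_instance that unfolding tiered_instance_def by fastforce
  qed
  obtain y where fit: "fits (supplies M) y"
    and le: "\<And>i. i \<in> {1..bidders M} \<Longrightarrow> y i \<le> ?D i"
    and eff: "efficient M y"
    using ex_efficient_within_demand by blast
  \<comment> \<open>An unsold item could be given to a bidder with positive marginal value for it,
    contradicting efficiency.\<close>
  have "sum y {1..bidders M} = sum (supplies M) {1..tiers M}"
  proof (rule ccontr)
    assume "\<not> ?thesis"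
    then have "sum y {1..bidders M} < sum (supplies M) {1..tiers M}"
      using total_le_if_fits[OF fit] by simp
    then obtain h where h: "h \<in> {1..bidders M}" "y h < ?D h" "fits (supplies M) (y(h := Suc (y h)))"
      using fits_augment[of "supplies M" y ?D] fit le cover by blast
    have "0 < valuation M h (Suc (y h))"
      using less_valuation_if_le_sincere_demand[OF h(1)] h(2) by simp
    moreover have "social_welfare M (y(h := Suc (y h))) \<le> social_welfare M y"
      using eff h(3) by (simp add: efficient_def feasible_allocation_def)
    ultimately show False by (simp only: social_welfare_add_unit[OF h(1)])
  qed
  then have "efficient_completion ?s y"
    using fit le eff unfolding efficient_completion_def demand by (simp add: initial_state_def)
  then show ?thesis
    using cover unfolding invariant_def oversubscribed_def within_supply_def demand
    by (auto simp: initial_state_def)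
qed

section \<open>Runs, termination and efficiency of the outcome\<close>

lemma invariant_step:
  assumes "auction_step M s s'" "invariant s"
  shows "invariant s'"
  using assms invariant_clinch invariant_raise_price by (cases rule: auction_step.cases) auto

lemma invariant_steps:
  assumes "(auction_step M)\<^sup>*\<^sup>* s s'" "invariant s"
  shows "invariant s'"
  using assms by induction (auto intro: invariant_step)

text \<open>Take the lexicographic minimum: the least \<open>t\<close> first, then the least
  \<open>i\<close> for it.\<close>

lemma ex_first_clinch:
  assumes "can_clinch M s t i"
  obtains t' i' where "first_clinch M s t' i'"
proof -
  define t0 where "t0 = (LEAST t. \<exists>i. can_clinch M s t i)"
  define i0 where "i0 = (LEAST i. can_clinch M s t0 i)"
  have "\<exists>i. can_clinch M s t0 i" unfolding t0_def using assms by (intro LeastI) blast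
  then have "can_clinch M s t0 i0" unfolding i0_def by (rule LeastI_ex)
  moreover have "t0 < t' \<or> t0 = t' \<and> i0 \<le> i'" if "can_clinch M s t' i'" for t' i'
  proof -
    have "t0 \<le> t'" unfolding t0_def using that by (intro Least_le) blast
    moreover have "i0 \<le> i'" if "t0 = t'"
      unfolding i0_def using \<open>can_clinch M s t' i'\<close> that by (intro Least_le) simp
    ultimately show ?thesis by linarith
  qed
  ultimately show thesis using that unfolding first_clinch_def by blast
qed

lemma auction_progress:
  assumes "invariant s" "\<not> final_state M s"
  obtains s' where "auction_step M s s'"
proof (cases "\<exists>t i. can_clinch M s t i")
  case True
  then obtain t i where first: "first_clinch M s t i" using ex_first_clinch by blast
  then obtain k where "lowest_acceptable M s i k"
    using assms(1) ex_lowest_acceptable unfolding invariant_def first_clinch_def by metis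
  then show thesis using auction_step.clinch[OF first] that by blast
next
  case False
  then show thesis using auction_step.raise_price[OF False] assms(2) that by (auto simp: final_state_def)
qed

text \<open>Clinching uses up an item, and the price rises only while it is below the largest
  valuation.\<close>

lemma auction_terminates:
  assumes "invariant s"
  shows "\<exists>s'. (auction_step M)\<^sup>*\<^sup>* s s' \<and> final_state M s'"
proof -
  \<comment> \<open>Inserting 0 keeps the set nonempty when there are no bidders or no
    items.\<close>
  define V where
    "V = Max (insert 0 ((\<lambda>(i, j). valuation M i j) ` ({1..bidders M} \<times> {1..total_supply M})))"
  have V: "valuation M i j \<le> V" if "i \<in> {1..bidders M}" "j \<in> {1..total_supply M}" for i j
    unfolding V_def using that by (intro Max_ge) force+
  let ?m = "\<lambda>s. nat (V - price s) + sum (remaining s) {1..tiers M}"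
  have decreases: "?m s' < ?m s" if step: "auction_step M s s'" and inv: "invariant s" for s s'
    using step
  proof cases
    case (clinch t i k)
    then have "i \<in> {1..bidders M}" by (simp add: first_clinch_def can_clinch_def)
    then have "k \<in> {1..tiers M}" "0 < remaining s k"
      using clinch(3) tier_bounds(1)[of i] by (auto simp: lowest_acceptable_def)
    then show ?thesis
      unfolding clinch(1) by (auto intro!: sum_strict_mono_ex1)
  next
    case raise_price
    \<comment> \<open>Oversubscription of the whole market yields a unit valued above the price.
      Hence \<open>price s < V\<close>, and the truncated difference really decreases.\<close>
    then have "sum (remaining s) {1..tiers M} \<noteq> 0" by simp
    then have "sum (residual_demand M s) {1..bidders M} \<noteq> 0"
      using inv oversubscribedD[of s "tiers M"] low_bidders_tiers by (auto simp: invariant_def)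
    then obtain i where i: "i \<in> {1..bidders M}" "0 < residual_demand M s i"
      by (meson gr0I sum.neutral)
    then have "1 \<le> sincere_demand M i (price s)" by (simp add: residual_demand_def)
    then have "price s < valuation M i 1" "1 \<le> total_supply M"
      using less_valuation_if_le_sincere_demand[OF i(1)] sincere_demand_le[of i "price s"] by auto
    then have "price s < V" using V[OF i(1), of 1] by simp
    then show ?thesis unfolding raise_price(1) by simp
  qed
  show ?thesis
    using assms
  proof (induction s rule: measure_induct_rule[of ?m])
    case (less s)
    show ?case
    proof (cases "final_state M s")
      case True
      then show ?thesis by blast
    next
      case False
      then obtain s' where s': "auction_step M s s'" using auction_progress less.prems by blast
      then show ?thesis
        using less.IH[OF decreases[OF s' less.prems] invariant_step[OF s' less.prems]]
        by (meson converse_rtranclp_into_rtranclp)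
    qed
  qed
qed

lemma efficient_if_final:
  assumes "invariant s" "final_state M s"
  shows "efficient M (clinched s)"
proof -
  obtain y where "efficient_completion s y" using assms(1) by (auto simp: invariant_def)
  moreover from this have "sum y {1..bidders M} = 0"
    using assms(2) by (simp add: efficient_completion_def final_state_def)
  ultimately show ?thesis
    using efficient_cong[of "\<lambda>i. clinched s i + y i" "clinched s"]
    by (simp add: efficient_completion_def)
qed

end

text \<open>An outcome requires a reachable final state, so its existence is asserted too; otherwise
  efficiency could hold vacuously.\<close>

theorem theorem12:
  fixes M :: market
  assumes "tiered_instance M"
  shows "(\<exists>x. auction_outcome M x) \<and> (\<forall>x. auction_outcome M x \<longrightarrow> efficient M x)"
proof -
  interpret tiered_market M by standard (fact assms)
  show ?thesis
    using auction_terminates[OF invariant_initial] invariant_steps[OF _ invariant_initial]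
      efficient_if_final
    unfolding auction_outcome_def by blast
qed

end
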